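(* Let $\mathbb{K}$ be a perfect field of characteristic $2$ and fix an integer $d\ge 6$. Consider universal conformal geometries $(V,Q,\Omega,P,L)$ over $\mathbb{K}$ (with a distinguished $\Omega$, in the sense of the context) with $\dim V=d$. Then the class $\operatorname{Arf}(V)\in\mathbb{K}^+/\mathfrak{H}(\mathbb{K})$ together with the values $\operatorname{Arf}\langle\Omega,P\rangle,\ \operatorname{Arf}\langle\Omega,L\rangle\in\mathbb{K}\cup\{\infty\}$ define the geometry; that is, any two such geometries $(V,Q,\Omega,P,L)$ and $(V',Q',\Omega',P',L')$ with $\dim V=\dim V'=d$, $\operatorname{Arf}(V)=\operatorname{Arf}(V')$ in $\mathbb{K}^+/\mathfrak{H}(\mathbb{K})$, $\operatorname{Arf}\langle\Omega,P\rangle=\operatorname{Arf}\langle\Omega',P'\rangle$ and $\operatorname{Arf}\langle\Omega,L\rangle=\operatorname{Arf}\langle\Omega',L'\rangle$ are isometric. The same holds for $d=4$, unless $\operatorname{Arf}\langle\Omega,P\rangle=\operatorname{Arf}\langle\Omega,L\rangle=0$. Moreover, in any such geometry one may assume that $Q(\Omega)=1$, i.e. the representative vector of $\Omega$ can be rescaled so that $Q(\Omega)=1$ without changing $\operatorname{Arf}(V)$, $\operatorname{Arf}\langle\Omega,P\rangle$ and $\operatorname{Arf}\langle\Omega,L\rangle$.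
   Context: $\mathbb{K}$ is a perfect field of characteristic $2$. A quadratic space $(V,Q)$ is a finite-dimensional $\mathbb{K}$-vector space with a quadratic form; its associated bilinear form is $B(x,y)=Q(x+y)-Q(x)-Q(y)$, and $(V,Q)$ is non-degenerate if $B$ is non-degenerate. Orthogonality $x\perp y$ means $B(x,y)=0$. $\mathfrak{H}(x)=x+x^2$ is an additive map $\mathbb{K}\to\mathbb{K}$, with image $\mathfrak{H}(\mathbb{K})$. Arf invariant: for two vectors $x,y$ put $\operatorname{Arf}\langle x,y\rangle=\frac{Q(x)Q(y)}{B(x,y)^2}$ if $B(x,y)\neq 0$, and $\operatorname{Arf}\langle x,y\rangle=\infty$ if $B(x,y)=0$; this is unchanged by rescaling $x$ and $y$. For a non-degenerate $(V,Q)$ decomposed as an orthogonal sum of $2$-dimensional subspaces with bases $(e_1^i,e_2^i)$, $\operatorname{Arf}(V)=\sum_i \operatorname{Arf}\langle e_1^i,e_2^i\rangle$, which is well defined as an element of $\mathbb{K}^+/\mathfrak{H}(\mathbb{K})$. A universal conformal geometry of even dimension $n$ is a tuple $(V,Q,\Omega,P,L)$, where $(V,Q)$ is a non-degenerate quadratic space over $\mathbb{K}$ of dimension $n+4$, and $\Omega,P,L\in\mathbb{P}V$ (represented by vectors, up to scalar) satisfy: $Q|_{\Omega^\perp}$ has trivial radical, equivalently $Q(\Omega)\neq 0$ (the radical of a quadratic form $q$ on $U$ is $\{v\in U: q(v+u)=q(u)\ \forall u\in U\}$); (0) $P\perp L$; (1) $\Omega,P,L$ are linearly independent; (2) $Q(P)\neq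 0$ or $\operatorname{Arf}\langle\Omega,P\rangle\neq\infty$, and likewise $Q(L)\neq0$ or $\operatorname{Arf}\langle\Omega,L\rangle\neq\infty$. Two geometries $(V,Q,\Omega,P,L)$ and $(V',Q',\Omega',P',L')$ are isometric if there is a linear isomorphism $V\to V'$ carrying $Q$ to $Q'$ under which the images of $\Omega,P,L$ are $\Omega',P',L'$ up to scalar multiples. *)

theory Defs
  imports Complex_Main
begin

(* In positive characteristic, a field is perfect iff its Frobenius map is surjective. *)
definition perfect_field :: "'k::field itself \<Rightarrow> bool" where
  "perfect_field _ \<longleftrightarrow> CHAR('k) = 0 \<or> surj (\<lambda>x::'k. x ^ CHAR('k))"

definition frakH :: "'k::field \<Rightarrow> 'k" where
  "frakH x = x + x\<^sup>2"

(* The class of a in the additive group of the field modulo the image of frakH, as a coset. *)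
definition frakH_class :: "'k::field \<Rightarrow> 'k set" where
  "frakH_class a = (\<lambda>h. a + h) ` range frakH"

definition polar :: "('v::ab_group_add \<Rightarrow> 'k::field) \<Rightarrow> 'v \<Rightarrow> 'v \<Rightarrow> 'k" where
  "polar Q x y = Q (x + y) - Q x - Q y"

definition orth :: "('v::ab_group_add \<Rightarrow> 'k::field) \<Rightarrow> 'v \<Rightarrow> 'v \<Rightarrow> bool" where
  "orth Q x y \<longleftrightarrow> polar Q x y = 0"

definition orth_compl :: "('v::ab_group_add \<Rightarrow> 'k::field) \<Rightarrow> 'v \<Rightarrow> 'v set" where
  "orth_compl Q x = {v. orth Q x v}"

definition radical_on :: "('v::ab_group_add \<Rightarrow> 'k::field) \<Rightarrow> 'v set \<Rightarrow> 'v set" where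
  "radical_on Q U = {v \<in> U. \<forall>u\<in>U. Q (v + u) = Q u}"

(* None stands for the value infinity. *)
definition arf_pair :: "('v::ab_group_add \<Rightarrow> 'k::field) \<Rightarrow> 'v \<Rightarrow> 'v \<Rightarrow> 'k option" where
  "arf_pair Q x y = (if polar Q x y = 0 then None else Some (Q x * Q y / (polar Q x y)\<^sup>2))"

(* The whole space is the orthogonal direct sum of the planes with bases (e1 i, e2 i), i < m. *)
definition orthogonal_plane_decomposition ::
    "('k::field \<Rightarrow> 'v::ab_group_add \<Rightarrow> 'v) \<Rightarrow> ('v \<Rightarrow> 'k) \<Rightarrow> nat \<Rightarrow> (nat \<Rightarrow> 'v) \<Rightarrow> (nat \<Rightarrow> 'v) \<Rightarrow> bool" where
  "orthogonal_plane_decomposition scale Q m e1 e2 \<longleftrightarrow>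
     (\<forall>i<m. e1 i \<noteq> e2 i \<and> \<not> module.dependent scale {e1 i, e2 i}) \<and>
     (\<forall>i<m. \<forall>j<m. i \<noteq> j \<longrightarrow>
        (\<forall>x\<in>module.span scale {e1 i, e2 i}. \<forall>y\<in>module.span scale {e1 j, e2 j}. orth Q x y)) \<and>
     (\<forall>v. \<exists>!u. (\<forall>i<m. u i \<in> module.span scale {e1 i, e2 i}) \<and> (\<forall>i\<ge>m. u i = 0) \<and>
        v = (\<Sum>i<m. u i))"

(* For a non-degenerate form in characteristic 2 such decompositions exist, every summand is
   finite (so "the" never meets None), and the class does not depend on the decomposition chosen. *)
definition arf_class ::
    "('k::field \<Rightarrow> 'v::ab_group_add \<Rightarrow> 'v) \<Rightarrow> ('v \<Rightarrow> 'k) \<Rightarrow> 'k set" where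
  "arf_class scale Q = (SOME C. \<exists>m e1 e2. orthogonal_plane_decomposition scale Q m e1 e2 \<and>
     C = frakH_class (\<Sum>i<m. the (arf_pair Q (e1 i) (e2 i))))"

locale quadratic_space = vector_space scale
  for scale :: "'k::field \<Rightarrow> 'v::ab_group_add \<Rightarrow> 'v" +
  fixes Q :: "'v \<Rightarrow> 'k"
  assumes finite_dimensional: "\<exists>B. finite_dimensional_vector_space scale B"
    and Q_scale: "Q (scale a x) = a\<^sup>2 * Q x"
    and polar_linear_left: "Vector_Spaces.linear scale (*) (\<lambda>x. polar Q x y)"
    and polar_linear_right: "Vector_Spaces.linear scale (*) (\<lambda>y. polar Q x y)"

locale nondegenerate_quadratic_space = quadratic_space +
  assumes nondegenerate: "(\<And>y. polar Q x y = 0) \<Longrightarrow> x = 0"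

(* The points Omega, P, L of projective space are given by representing vectors. *)
locale universal_conformal_geometry = nondegenerate_quadratic_space scale Q
  for scale :: "'k::field \<Rightarrow> 'v::ab_group_add \<Rightarrow> 'v" and Q :: "'v \<Rightarrow> 'k" +
  fixes \<Omega> P L :: 'v
  assumes dim_even: "\<exists>n. even n \<and> dim UNIV = n + 4"
    and radical_trivial: "radical_on Q (orth_compl Q \<Omega>) = {0}"
    and P_orth_L: "orth Q P L"
    and distinct_points: "distinct [\<Omega>, P, L]"
    and independent_points: "independent {\<Omega>, P, L}"
    and P_condition: "Q P \<noteq> 0 \<or> arf_pair Q \<Omega> P \<noteq> None"
    and L_condition: "Q L \<noteq> 0 \<or> arf_pair Q \<Omega> L \<noteq> None"

definition isometric_geometries ::
    "('k::field \<Rightarrow> 'v::ab_group_add \<Rightarrow> 'v) \<Rightarrow> ('v \<Rightarrow> 'k) \<Rightarrow> 'v \<Rightarrow> 'v \<Rightarrow> 'v \<Rightarrow>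
     ('k \<Rightarrow> 'w::ab_group_add \<Rightarrow> 'w) \<Rightarrow> ('w \<Rightarrow> 'k) \<Rightarrow> 'w \<Rightarrow> 'w \<Rightarrow> 'w \<Rightarrow> bool" where
  "isometric_geometries scale Q \<Omega> P L scale' Q' \<Omega>' P' L' \<longleftrightarrow>
     (\<exists>f. Vector_Spaces.linear scale scale' f \<and> bij f \<and> (\<forall>x. Q' (f x) = Q x) \<and>
        (\<exists>a. a \<noteq> 0 \<and> f \<Omega> = scale' a \<Omega>') \<and>
        (\<exists>b. b \<noteq> 0 \<and> f P = scale' b P') \<and>
        (\<exists>c. c \<noteq> 0 \<and> f L = scale' c L'))"

end

theory Submission
  imports Defs
begin

text \<open>The values \<open>Arf\<langle>\<Omega>, P\<rangle>\<close> and \<open>Arf\<langle>\<Omega>, L\<rangle>\<close> are exactly what is left of the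
Gram data of the triple \<open>(\<Omega>, P, L)\<close> after rescaling the three vectors. Since \<open>Q(\<Omega>) \<noteq> 0\<close> and the field is
perfect, \<open>Q(\<Omega>)\<close> can be given any nonzero value. If \<open>B(\<Omega>, P) \<noteq> 0\<close>, this pairing can also be given any nonzero
value, and the Arf invariant then determines \<open>Q(P)\<close>. If \<open>B(\<Omega>, P) = 0\<close>, then \<open>Q(P) \<noteq> 0\<close> is part of the
definition of a geometry, and \<open>Q(P)\<close> can be given any nonzero value. The same holds for \<open>L\<close>, and
\<open>B(P, L) = 0\<close>. So, for two geometries with the same invariants, the vectors can be rescaled such that
\<open>\<Omega> \<mapsto> \<Omega>'\<close>, \<open>P \<mapsto> P'\<close>, \<open>L \<mapsto> L'\<close> is an isometry of the spanned subspaces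
(\<open>matching_multiple\<close>).

Two facts on quadratic spaces over a perfect field of characteristic 2 finish the argument. The
dimension and the Arf class determine the space up to isometry (\<open>isometric_if_arf_class_eq\<close>): every
symplectic basis can be changed into one for which all planes but one are hyperbolic, and the value
in the exceptional plane is a representative of the Arf class, which can be changed by any \<open>c + c\<^sup>2\<close>.
And, as soon as the two spaces are isometric, an isometry between subspaces extends to the whole
spaces: this is Witt's theorem (\<open>witt_extension\<close>), which holds for quadratic forms with
non-degenerate \<open>B\<close>.

In characteristic 2 the form \<open>B\<close> is alternating and signs disappear, which explains the absence of
minus signs in most formulas.\<close>

section \<open>Quadratic forms in characteristic 2\<close>

locale char2_quadratic_space = nondegenerate_quadratic_space scale Q
  for scale :: "'k::field \<Rightarrow> 'v::ab_group_add \<Rightarrow> 'v" (infixr \<open>*s\<close> 75) and Q :: "'v \<Rightarrow> 'k" +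
  assumes CHAR_2: "CHAR('k) = 2"
begin

abbreviation B :: "'v \<Rightarrow> 'v \<Rightarrow> 'k" where "B \<equiv> polar Q"

lemma two_eq_0 [simp]: "(2::'k) = 0"
  using of_nat_CHAR[where 'a='k] CHAR_2 by simp

lemma scalar_add_self [simp]: "(a::'k) + a = 0"
  by (metis mult_2 mult_zero_left two_eq_0)

lemma vector_add_self [simp]: "(x::'v) + x = 0"
  by (metis scalar_add_self scale_left_distrib scale_one scale_zero_left)

lemma vector_uminus [simp]: "- (x::'v) = x"
  by (metis add_eq_0_iff2 vector_add_self)

lemma scalar_uminus [simp]: "- (a::'k) = a"
  by (metis add_eq_0_iff2 scalar_add_self)

lemma vector_diff: "(x::'v) - y = x + y"
  by (metis add_uminus_conv_diff vector_uminus)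

lemma scalar_diff: "(a::'k) - b = a + b"
  by (metis add_uminus_conv_diff scalar_uminus)

lemma B_add_left: "B (x + y) z = B x z + B y z"
  and B_scale_left: "B (a *s x) z = a * B x z"
  using polar_linear_left[of z] unfolding Vector_Spaces.linear_iff by auto

lemma B_add_right: "B z (x + y) = B z x + B z y"
  and B_scale_right: "B z (a *s x) = a * B z x"
  using polar_linear_right[of z] unfolding Vector_Spaces.linear_iff by auto

lemma B_zero [simp]: "B 0 x = 0" "B x 0 = 0"
  using B_scale_left[of 0 0 x] B_scale_right[of x 0 0] by simp_all

lemma Q_zero [simp]: "Q 0 = 0"
  using Q_scale[of 0 0] by simp

lemma Q_add: "Q (x + y) = Q x + Q y + B x y"
  by (simp add: polar_def)

lemma B_self [simp]: "B x x = 0"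
  by (simp add: polar_def scalar_diff)

lemma B_commute: "B x y = B y x"
  by (simp add: polar_def add.commute)

lemmas B_bilinear = B_add_left B_add_right B_scale_left B_scale_right

lemma B_sum_left: "B (\<Sum>i\<in>I. g i) y = (\<Sum>i\<in>I. B (g i) y)"
  by (induction I rule: infinite_finite_induct) (simp_all add: B_add_left)

lemma B_sum_right: "B y (\<Sum>i\<in>I. g i) = (\<Sum>i\<in>I. B y (g i))"
  by (induction I rule: infinite_finite_induct) (simp_all add: B_add_right)

lemma Q_sum_orthogonal:
  assumes "\<And>i j. i \<in> I \<Longrightarrow> j \<in> I \<Longrightarrow> i \<noteq> j \<Longrightarrow> B (g i) (g j) = 0"
  shows "Q (\<Sum>i\<in>I. g i) = (\<Sum>i\<in>I. Q (g i))"
  using assms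
proof (induction I rule: infinite_finite_induct)
  case (insert i I)
  have "B (g i) (\<Sum>j\<in>I. g j) = 0"
    unfolding B_sum_right by (intro sum.neutral ballI insert.prems) (use insert in auto)
  then show ?case using insert by (simp add: Q_add)
qed simp_all

lemma B_eq_0_on_span:
  assumes "\<And>h. h \<in> H \<Longrightarrow> B h y = 0" "x \<in> span H"
  shows "B x y = 0"
  using assms(2) by (induction rule: span_induct_alt) (simp_all add: B_bilinear assms(1))

text \<open>A vector \<open>b\<close> in the span of the others would be orthogonal to its own dual vector.\<close>

lemma independent_if_dual_vectors:
  assumes "\<And>b. b \<in> S \<Longrightarrow> \<exists>y. B b y \<noteq> 0 \<and> (\<forall>c\<in>S - {b}. B c y = 0)"
  shows "independent S"
proof
  assume "dependent S"
  then obtain b where b: "b \<in> S" "b \<in> span (S - {b})"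
    unfolding dependent_def by blast
  then obtain y where "B b y \<noteq> 0" "\<forall>c\<in>S - {b}. B c y = 0" using assms by blast
  then show False using B_eq_0_on_span[OF _ b(2)] by blast
qed

end

section \<open>Symplectic bases\<close>

context char2_quadratic_space
begin

definition symplectic_family :: "nat \<Rightarrow> (nat \<Rightarrow> 'v) \<Rightarrow> (nat \<Rightarrow> 'v) \<Rightarrow> bool" where
  "symplectic_family m e f \<longleftrightarrow>
     (\<forall>i<m. \<forall>j<m. B (e i) (f j) = (if i = j then 1 else 0) \<and> B (e i) (e j) = 0 \<and> B (f i) (f j) = 0)"

text \<open>Being a basis is expressed as the vanishing of everything orthogonal to the family. For a
symplectic family this is equivalent to spanning, by the expansion below and non-degeneracy, and it passes easily to a
new family: it only has to be seen that orthogonality to the new vectors implies orthogonality to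
the old ones.\<close>

definition symplectic_basis :: "nat \<Rightarrow> (nat \<Rightarrow> 'v) \<Rightarrow> (nat \<Rightarrow> 'v) \<Rightarrow> bool" where
  "symplectic_basis m e f \<longleftrightarrow> symplectic_family m e f \<and>
     (\<forall>x. (\<forall>i<m. B x (e i) = 0 \<and> B x (f i) = 0) \<longrightarrow> x = 0)"

definition combine :: "nat \<Rightarrow> (nat \<Rightarrow> 'v) \<Rightarrow> (nat \<Rightarrow> 'v) \<Rightarrow> (nat \<Rightarrow> 'k) \<Rightarrow> (nat \<Rightarrow> 'k) \<Rightarrow> 'v" where
  "combine m e f a b = (\<Sum>i<m. a i *s e i + b i *s f i)"

lemma symplectic_familyD:
  assumes "symplectic_family m e f" "i < m" "j < m"
  shows "B (e i) (f j) = (if i = j then 1 else 0)" "B (f i) (e j) = (if i = j then 1 else 0)"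
    "B (e i) (e j) = 0" "B (f i) (f j) = 0"
  using assms unfolding symplectic_family_def by (auto simp: B_commute[of "f i" "e j"])

lemma B_combine:
  assumes "symplectic_family m e f" "j < m"
  shows "B (combine m e f a b) (e j) = b j" "B (combine m e f a b) (f j) = a j"
proof -
  have "B (combine m e f a b) (e j) = (\<Sum>i<m. if i = j then b i else 0)"
    unfolding combine_def B_sum_left using assms
    by (intro sum.cong) (auto simp: B_bilinear symplectic_familyD)
  also have "\<dots> = b j" using assms(2) by simp
  finally show "B (combine m e f a b) (e j) = b j" .
  have "B (combine m e f a b) (f j) = (\<Sum>i<m. if i = j then a i else 0)"
    unfolding combine_def B_sum_left using assms
    by (intro sum.cong) (auto simp: B_bilinear symplectic_familyD)
  also have "\<dots> = a j" using assms(2) by simp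
  finally show "B (combine m e f a b) (f j) = a j" .
qed

lemma Q_combine:
  assumes "symplectic_family m e f"
  shows "Q (combine m e f a b) = (\<Sum>i<m. (a i)\<^sup>2 * Q (e i) + (b i)\<^sup>2 * Q (f i) + a i * b i)"
proof -
  have "Q (combine m e f a b) = (\<Sum>i<m. Q (a i *s e i + b i *s f i))"
    unfolding combine_def using assms
    by (intro Q_sum_orthogonal) (auto simp: B_bilinear symplectic_familyD)
  also have "\<dots> = (\<Sum>i<m. (a i)\<^sup>2 * Q (e i) + (b i)\<^sup>2 * Q (f i) + a i * b i)"
    using assms by (intro sum.cong) (auto simp: Q_add Q_scale B_bilinear symplectic_familyD)
  finally show ?thesis .
qed

text \<open>The difference of the two sides is orthogonal to every \<open>e\<^sub>i\<close> and \<open>f\<^sub>i\<close>.\<close>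

lemma symplectic_expansion:
  assumes "symplectic_basis m e f"
  shows "combine m e f (\<lambda>i. B x (f i)) (\<lambda>i. B x (e i)) = x"
proof -
  let ?y = "combine m e f (\<lambda>i. B x (f i)) (\<lambda>i. B x (e i))"
  have "x + ?y = 0"
    using assms unfolding symplectic_basis_def
    by (elim conjE allE[of _ "x + ?y"] impE) (simp_all add: B_bilinear B_combine)
  then show ?thesis using vector_diff[of x ?y] by simp
qed

lemma symplectic_family_vectors:
  assumes "symplectic_family m e f"
  shows "independent (e ` {..<m} \<union> f ` {..<m})" "card (e ` {..<m} \<union> f ` {..<m}) = 2 * m"
proof -
  let ?S = "e ` {..<m} \<union> f ` {..<m}"
  note D = symplectic_familyD[OF assms]
  show "independent ?S"
  proof (rule independent_if_dual_vectors)
    fix b assume "b \<in> ?S"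
    then consider i where "i < m" "b = e i" | i where "i < m" "b = f i" by blast
    then show "\<exists>y. B b y \<noteq> 0 \<and> (\<forall>c\<in>?S - {b}. B c y = 0)"
    proof cases
      case 1
      then show ?thesis by (intro exI[of _ "f i"]) (auto simp: D split: if_splits)
    next
      case 2
      then show ?thesis by (intro exI[of _ "e i"]) (auto simp: D split: if_splits)
    qed
  qed
  have "inj_on e {..<m}"
    by (rule inj_onI) (metis D(1) lessThan_iff zero_neq_one)
  moreover have "inj_on f {..<m}"
    by (rule inj_onI) (metis D(1) lessThan_iff zero_neq_one)
  moreover have "e ` {..<m} \<inter> f ` {..<m} = {}"
    using D(1,3) by (smt (verit) disjoint_iff imageE lessThan_iff zero_neq_one)
  ultimately show "card ?S = 2 * m"
    by (simp add: card_Un_disjoint card_image)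
qed

lemma symplectic_basis_dim:
  assumes "symplectic_basis m e f"
  shows "dim UNIV = 2 * m"
proof -
  let ?S = "e ` {..<m} \<union> f ` {..<m}"
  have fam: "symplectic_family m e f" using assms unfolding symplectic_basis_def by blast
  have "combine m e f a b \<in> span ?S" for a b
    unfolding combine_def by (intro span_sum span_add span_scale span_base) auto
  then have "span ?S = UNIV" using symplectic_expansion[OF assms] by (metis UNIV_eq_I)
  then have "dim UNIV = card ?S"
    using symplectic_family_vectors(1)[OF fam] by (intro dim_eq_card) auto
  then show ?thesis using symplectic_family_vectors(2)[OF fam] by simp
qed

text \<open>A symplectic family of maximal size is a basis: a nonzero vector \<open>x\<close> orthogonal to it pairs
nontrivially with some \<open>y\<close>, and \<open>x\<close> together with the component of \<open>y\<close> orthogonal to the family,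
suitably rescaled, would enlarge the family.\<close>

lemma symplectic_basis_exists:
  obtains m e f where "symplectic_basis m e f"
proof -
  obtain Bs where "finite_dimensional_vector_space scale Bs" using finite_dimensional by blast
  then interpret fin: finite_dimensional_vector_space scale Bs .
  have bound: "m \<le> dim UNIV" if ex: "\<exists>e f. symplectic_family m e f" for m
  proof -
    obtain e f where "symplectic_family m e f" using ex by blast
    from symplectic_family_vectors[OF this] show ?thesis
      using fin.independent_card_le_dim[of "e ` {..<m} \<union> f ` {..<m}" UNIV] by simp
  qed
  define m where "m = (GREATEST m. \<exists>e f. symplectic_family m e f)"
  have "\<exists>e f. symplectic_family 0 e f" by (simp add: symplectic_family_def)
  then have "\<exists>e f. symplectic_family m e f"
    unfolding m_def using bound by (rule GreatestI_nat)
  then obtain e f where fam: "symplectic_family m e f" by blast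
  have maximal: "\<not> symplectic_family (Suc m) e' f'" for e' f'
  proof
    assume "symplectic_family (Suc m) e' f'"
    then have "Suc m \<le> m"
      unfolding m_def
      using Greatest_le_nat[of "\<lambda>m. \<exists>e f. symplectic_family m e f" "Suc m" "dim UNIV"] bound
      unfolding m_def by blast
    then show False by simp
  qed
  have "x = 0" if x: "\<forall>i<m. B x (e i) = 0 \<and> B x (f i) = 0" for x
  proof (rule ccontr)
    assume "x \<noteq> 0"
    then obtain y where y: "B x y \<noteq> 0" using nondegenerate by blast
    define z where "z = inverse (B x y) *s (y + combine m e f (\<lambda>i. B y (f i)) (\<lambda>i. B y (e i)))"
    have "B x (combine m e f a b) = 0" for a b
      unfolding combine_def B_sum_right using x by (simp add: B_bilinear)
    then have xz: "B x z = 1" using y by (simp add: z_def B_bilinear)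
    have z: "B z (e i) = 0" "B z (f i) = 0" if "i < m" for i
      using that fam by (simp_all add: z_def B_bilinear B_combine)
    have x': "B (e i) x = 0" "B (f i) x = 0" and z': "B (e i) z = 0" "B (f i) z = 0" if "i < m" for i
      using x z that by (simp_all add: B_commute[of "e i"] B_commute[of "f i"])
    have "symplectic_family (Suc m) (e(m := x)) (f(m := z))"
      unfolding symplectic_family_def
      using x xz z x' z' symplectic_familyD[OF fam] by (auto simp: less_Suc_eq)
    then show False using maximal by blast
  qed
  then have "symplectic_basis m e f" using fam unfolding symplectic_basis_def by blast
  then show thesis by (rule that)
qed

lemma functional_represented:
  assumes "Vector_Spaces.linear scale (*) \<phi>"
  obtains y where "\<And>x. \<phi> x = B x y"
proof -
  interpret \<phi>: Vector_Spaces.linear scale "(*)" \<phi> by fact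
  obtain m e f where basis: "symplectic_basis m e f" by (rule symplectic_basis_exists)
  then have fam: "symplectic_family m e f" by (simp add: symplectic_basis_def)
  define y where "y = combine m e f (\<lambda>i. \<phi> (f i)) (\<lambda>i. \<phi> (e i))"
  have on_basis: "B (e i) y = \<phi> (e i)" "B (f i) y = \<phi> (f i)" if "i < m" for i
    using that fam by (simp_all add: y_def B_commute[of _ "combine _ _ _ _ _"] B_combine)
  have "\<phi> x = B x y" for x
  proof -
    have "\<phi> (combine m e f a b) = B (combine m e f a b) y" for a b
      unfolding combine_def \<phi>.sum B_sum_left
      by (intro sum.cong) (auto simp: \<phi>.add \<phi>.scale B_bilinear on_basis)
    then show ?thesis using symplectic_expansion[OF basis] by metis
  qed
  then show thesis by (rule that)
qed

text \<open>This is the part of \<open>H\<^sup>\<bottom>\<^sup>\<bottom> = \<langle>H\<rangle>\<close> that supplies the auxiliary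
vectors in Witt's theorem: a linear functional vanishing on \<open>H\<close> but not at \<open>u\<close> is represented by a
vector, because \<open>B\<close> is non-degenerate.\<close>

lemma separating_vector:
  assumes "u \<notin> span H"
  obtains y where "B u y = 1" "\<And>h. h \<in> span H \<Longrightarrow> B h y = 0"
proof -
  obtain C where C: "C \<subseteq> H" "independent C" "H \<subseteq> span C"
    using maximal_independent_subset[of H] by blast
  then have uC: "u \<notin> span C" using assms span_mono by blast
  then have ind: "independent (insert u C)" using C(2) by (simp add: independent_insert)
  have "vector_space ((*) :: 'k \<Rightarrow> 'k \<Rightarrow> 'k)"
    using polar_linear_left[of 0] unfolding Vector_Spaces.linear_iff by blast
  then interpret pair: vector_space_pair scale "(*) :: 'k \<Rightarrow> 'k \<Rightarrow> 'k"
    by (intro vector_space_pair.intro vector_space_axioms)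
  obtain \<phi> where \<phi>: "Vector_Spaces.linear scale (*) \<phi>"
      "\<forall>x\<in>insert u C. \<phi> x = (if x = u then 1 else 0)"
    using pair.linear_independent_extend[OF ind, of "\<lambda>x. if x = u then 1 else 0"] by blast
  obtain y where y: "\<And>x. \<phi> x = B x y" using functional_represented[OF \<phi>(1)] by blast
  have "B c y = 0" if "c \<in> C" for c
    using \<phi>(2) that uC span_base[of c C] y[of c] by (auto split: if_splits)
  then have "B h y = 0" if "h \<in> span H" for h
    using B_eq_0_on_span[of C y h] that C(3) span_mono[of H "span C"] span_span by blast
  moreover have "B u y = 1" using \<phi>(2) y by (metis insertI1)
  ultimately show thesis by (intro that)
qed

end

section \<open>Isometries and the extension theorem of Witt\<close>

definition isometry ::
    "('k::field \<Rightarrow> 'v::ab_group_add \<Rightarrow> 'v) \<Rightarrow> ('v \<Rightarrow> 'k) \<Rightarrow>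
     ('k \<Rightarrow> 'w::ab_group_add \<Rightarrow> 'w) \<Rightarrow> ('w \<Rightarrow> 'k) \<Rightarrow> ('v \<Rightarrow> 'w) \<Rightarrow> bool" where
  "isometry scale Q scale' Q' f \<longleftrightarrow>
     Vector_Spaces.linear scale scale' f \<and> (\<forall>x. Q' (f x) = Q x)"

context char2_quadratic_space
begin

abbreviation isometry_self :: "('v \<Rightarrow> 'v) \<Rightarrow> bool" where
  "isometry_self \<equiv> isometry scale Q scale Q"

lemma isometry_selfI:
  assumes "\<And>x y. f (x + y) = f x + f y" "\<And>a x. f (a *s x) = a *s f x" "\<And>x. Q (f x) = Q x"
  shows "isometry_self f"
  using assms vector_space_axioms unfolding isometry_def Vector_Spaces.linear_iff by simp

lemma isometry_reflection:
  assumes "Q z \<noteq> 0"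
  shows "isometry_self (\<lambda>x. x + (B x z / Q z) *s z)"
proof (rule isometry_selfI)
  show "Q (x + (B x z / Q z) *s z) = Q x" for x
    using assms by (simp add: Q_add Q_scale B_bilinear power2_eq_square)
qed (simp_all add: B_bilinear scale_left_distrib scale_right_distrib add_divide_distrib ac_simps)

text \<open>This is the Siegel transvection (Eichler transformation) attached to a singular vector \<open>z\<close> and a vector \<open>y \<bottom> z\<close>.\<close>

lemma isometry_transvection:
  assumes "Q z = 0" "B z y = 0"
  shows "isometry_self (\<lambda>x. x + (B x z *s y + (B x y + Q y * B x z) *s z))"
proof (rule isometry_selfI)
  show "Q (x + (B x z *s y + (B x y + Q y * B x z) *s z)) = Q x" for x
  proof -
    have "Q (x + (B x z *s y + (B x y + Q y * B x z) *s z))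
      = Q x + 2 * (B x z * B x y + (B x z)\<^sup>2 * Q y)"
      using assms by (simp add: Q_add Q_scale B_commute[of y z] B_bilinear power2_eq_square algebra_simps)
    then show ?thesis by simp
  qed
qed (simp_all add: B_bilinear scale_left_distrib scale_right_distrib distrib_left distrib_right ac_simps)

text \<open>On the hyperbolic plane \<open>\<langle>z, y\<rangle>\<close> this is \<open>z \<mapsto> s z\<close>, \<open>y \<mapsto> t y\<close> with \<open>s t = 1\<close>, and on
its orthogonal complement it is the identity.\<close>

lemma isometry_hyperbolic_dilation:
  assumes "Q z = 0" "Q y = 0" "B z y = 1" "s * t = 1"
  shows "isometry_self (\<lambda>x. x + (((s + 1) * B x y) *s z + ((t + 1) * B x z) *s y))"
proof (rule isometry_selfI)
  show "Q (x + (((s + 1) * B x y) *s z + ((t + 1) * B x z) *s y)) = Q x" for x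
  proof -
    have "Q (x + (((s + 1) * B x y) *s z + ((t + 1) * B x z) *s y))
      = Q x + ((s + 1) + (t + 1) + (s + 1) * (t + 1)) * (B x y * B x z)"
      using assms(1-3) by (simp add: B_commute[of y z] Q_add Q_scale B_bilinear power2_eq_square algebra_simps)
    also have "(s + 1) + (t + 1) + (s + 1) * (t + 1) = s * t + 2 * (s + t + 1) + 1"
      by (simp add: algebra_simps)
    also have "\<dots> = 0" using assms(4) by simp
    finally show ?thesis by simp
  qed
qed (simp_all add: B_bilinear scale_left_distrib scale_right_distrib distrib_left distrib_right ac_simps)

text \<open>Put \<open>z = a + b\<close>. The hypotheses say that \<open>z\<close> is orthogonal to \<open>H\<close> and that \<open>B(a, z) = Q(z)\<close>.
If \<open>Q(z) \<noteq> 0\<close>, the reflection in \<open>z\<close> moves \<open>a\<close> to \<open>b\<close>. If \<open>z\<close> is singular, there are two cases.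
When \<open>a \<notin> \<langle>H, z\<rangle>\<close>, some \<open>y\<close> orthogonal to \<open>H\<close> and \<open>z\<close> has \<open>B(a, y) = 1\<close>, and the Siegel
transvection of \<open>z\<close> and \<open>y\<close> adds \<open>z\<close> to \<open>a\<close>. When \<open>a = h\<^sub>0 + c z\<close> with \<open>h\<^sub>0 \<in> \<langle>H\<rangle>\<close>, what is needed is a
map that fixes \<open>H\<close> and multiplies \<open>z\<close> by \<open>(c + 1)/c\<close>; a dilation of a hyperbolic plane that contains
\<open>z\<close> and is orthogonal to \<open>H\<close> does this. Working with these three kinds of maps, rather than
with products of reflections, makes the argument valid over every field of characteristic 2,
including the one with two elements.\<close>

lemma witt_step:
  assumes "a \<notin> span H" "b \<notin> span H" "Q a = Q b" "\<And>h. h \<in> H \<Longrightarrow> B h a = B h b"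
  obtains g where "isometry_self g" "\<And>h. h \<in> H \<Longrightarrow> g h = h" "g a = b"
proof -
  define z where "z = a + b"
  have b: "b = a + z" by (simp add: z_def flip: add.assoc)
  have zH: "B h z = 0" if "h \<in> H" for h
    using assms(4)[OF that] by (simp add: z_def B_bilinear)
  have zspan: "B h z = 0" if "h \<in> span H" for h using B_eq_0_on_span[OF zH that] .
  have "Q b = Q a + (Q z + B a z)" by (simp add: b Q_add)
  then have Qz: "B a z = Q z" using assms(3) by (simp add: eq_neg_iff_add_eq_0[symmetric] add.commute)
  consider "Q z \<noteq> 0" | "Q z = 0" "a \<notin> span (insert z H)" | "Q z = 0" "a \<in> span (insert z H)"
    by blast
  then show thesis
  proof cases
    case 1
    let ?g = "\<lambda>x. x + (B x z / Q z) *s z"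
    show thesis
    proof (rule that[of ?g])
      show "isometry_self ?g" using 1 by (rule isometry_reflection)
      show "?g h = h" if "h \<in> H" for h using zH[OF that] by simp
      show "?g a = b" using 1 by (simp add: Qz b)
    qed
  next
    case 2
    obtain y where y: "B a y = 1" "\<And>h. h \<in> span (insert z H) \<Longrightarrow> B h y = 0"
      using 2(2) by (rule separating_vector) blast
    have zy: "B z y = 0" using y(2)[of z] by (simp add: span_base)
    let ?g = "\<lambda>x. x + (B x z *s y + (B x y + Q y * B x z) *s z)"
    show thesis
    proof (rule that[of ?g])
      show "isometry_self ?g" using 2(1) zy by (rule isometry_transvection)
      show "?g h = h" if "h \<in> H" for h using zH[OF that] y(2)[of h] that by (simp add: span_base)
      show "?g a = b" using 2(1) by (simp add: Qz y(1) b)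
    qed
  next
    case 3
    then obtain c where c: "a - c *s z \<in> span H" by (auto simp: span_breakdown_eq)
    define h0 where "h0 = a - c *s z"
    have a: "a = h0 + c *s z" by (simp add: h0_def)
    have h0: "h0 \<in> span H" using c by (simp add: h0_def)
    have "c \<noteq> 0" using h0 a assms(1) by auto
    have "c \<noteq> 1"
    proof
      assume "c = 1"
      then have "b = h0" by (simp add: b a flip: add.assoc)
      then show False using h0 assms(2) by simp
    qed
    have "z \<notin> span H"
      using a h0 assms(1) span_add span_scale by metis
    then obtain y where y: "B z y = 1" "\<And>h. h \<in> span H \<Longrightarrow> B h y = 0"
      by (rule separating_vector) blast
    \<comment> \<open>Adding a multiple of the singular vector \<open>z\<close> makes \<open>y\<close> singular and keeps its pairings with \<open>H\<close> and \<open>z\<close>.\<close>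
    define y' where "y' = y + Q y *s z"
    have y': "B z y' = 1" "\<And>h. h \<in> span H \<Longrightarrow> B h y' = 0" "Q y' = 0"
      using y zspan 3(1) by (simp_all add: y'_def B_bilinear Q_add Q_scale B_commute[of y z])
    \<comment> \<open>The solution of \<open>c s = c + 1\<close>; it is nonzero because \<open>c = 1\<close> would put \<open>b\<close> into the span of \<open>H\<close>.\<close>
    define s where "s = 1 + inverse c"
    have "s \<noteq> 0"
    proof
      assume "s = 0"
      then have "inverse c = 1" unfolding s_def by (metis add_eq_0_iff scalar_uminus)
      then show False using \<open>c \<noteq> 1\<close> by (metis inverse_1 inverse_inverse_eq)
    qed
    let ?g = "\<lambda>x. x + (((s + 1) * B x y') *s z + ((inverse s + 1) * B x z) *s y')"
    show thesis
    proof (rule that[of ?g])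
      show "isometry_self ?g"
        using 3(1) y'(3,1) \<open>s \<noteq> 0\<close> by (intro isometry_hyperbolic_dilation) simp_all
      show "?g h = h" if "h \<in> H" for h using zH[OF that] y'(2)[of h] that by (simp add: span_base)
      have "B a y' = c" using y'(1) y'(2)[OF h0] by (simp add: a B_bilinear)
      moreover have "s + 1 = inverse c" by (simp add: s_def add.commute[of 1] add.assoc)
      ultimately show "?g a = b" using 3(1) \<open>c \<noteq> 0\<close> by (simp add: Qz b)
    qed
  qed
qed

end

locale char2_quadratic_space_pair =
  V: char2_quadratic_space scale Q + W: char2_quadratic_space scale' Q'
  for scale :: "'k::field \<Rightarrow> 'v::ab_group_add \<Rightarrow> 'v" and Q :: "'v \<Rightarrow> 'k"
    and scale' :: "'k \<Rightarrow> 'w::ab_group_add \<Rightarrow> 'w" and Q' :: "'w \<Rightarrow> 'k"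
begin

lemma isometry_polar:
  assumes "isometry scale Q scale' Q' f"
  shows "polar Q' (f x) (f y) = polar Q x y"
proof -
  have "f (x + y) = f x + f y" using assms unfolding isometry_def Vector_Spaces.linear_iff by blast
  then show ?thesis using assms unfolding isometry_def polar_def by metis
qed

lemma isometry_inj:
  assumes "isometry scale Q scale' Q' f"
  shows "inj f"
proof (rule injI)
  interpret f: Vector_Spaces.linear scale scale' f using assms by (simp add: isometry_def)
  fix x y assume "f x = f y"
  then have "polar Q (x - y) z = 0" for z
    using isometry_polar[OF assms, of "x - y" z] by (simp add: f.diff)
  then show "x = y" using V.nondegenerate[of "x - y"] by simp
qed

lemma isometry_bij:
  assumes "isometry scale Q scale' Q' f" "V.dim UNIV = W.dim UNIV"
  shows "bij f"
proof -
  obtain B1 B2 where "finite_dimensional_vector_space scale B1" "finite_dimensional_vector_space scale' B2"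
    using V.finite_dimensional W.finite_dimensional by blast
  then interpret finite_dimensional_vector_space_pair scale B1 scale' B2
    by (intro finite_dimensional_vector_space_pair.intro)
  show ?thesis
    using linear_injective_imp_surjective[of f] isometry_inj[OF assms(1)] assms
    by (simp add: isometry_def bij_def)
qed

text \<open>The extension is built one vector of \<open>S\<close> at a time. An isometry \<open>g\<close> that is already correct on
\<open>S\<close> is composed with an isometry of the target that fixes \<open>\<sigma>(S)\<close> and moves \<open>g(u)\<close> to \<open>\<sigma>(u)\<close>. The
given isometry \<open>f\<close> is only the starting point: it says that the two spaces are isometric at all.\<close>

theorem witt_extension:
  assumes iso: "isometry scale Q scale' Q' f"
    and "finite S" "V.independent S" "inj_on \<sigma> S" "W.independent (\<sigma> ` S)"
    and "\<And>x. x \<in> S \<Longrightarrow> Q' (\<sigma> x) = Q x"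
    and "\<And>x y. x \<in> S \<Longrightarrow> y \<in> S \<Longrightarrow> polar Q' (\<sigma> x) (\<sigma> y) = polar Q x y"
  obtains g where "isometry scale Q scale' Q' g" "\<And>x. x \<in> S \<Longrightarrow> g x = \<sigma> x"
proof -
  have "\<exists>g. isometry scale Q scale' Q' g \<and> (\<forall>x\<in>S. g x = \<sigma> x)"
    using assms(2-)
  proof (induction S rule: finite_induct)
    case empty
    then show ?case using iso by auto
  next
    case (insert u S)
    then have "\<exists>g. isometry scale Q scale' Q' g \<and> (\<forall>x\<in>S. g x = \<sigma> x)"
      using V.independent_mono[OF insert.prems(1)] W.independent_mono[OF insert.prems(3)]
      by (intro insert.IH) (auto simp: subset_insertI)
    then obtain g where g: "isometry scale Q scale' Q' g" "\<forall>x\<in>S. g x = \<sigma> x" by blast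
    interpret g: Vector_Spaces.linear scale scale' g using g(1) by (simp add: isometry_def)
    have gS: "g ` S = \<sigma> ` S" using g(2) by auto
    have "u \<notin> V.span S" using insert.prems(1) insert.hyps(2) by (simp add: V.independent_insert)
    then have gu: "g u \<notin> W.span (\<sigma> ` S)"
      unfolding gS[symmetric] g.span_image using isometry_inj[OF g(1)] by (auto dest: injD)
    have "\<sigma> u \<notin> \<sigma> ` S" using insert.prems(2) insert.hyps(2) by auto
    then have \<sigma>u: "\<sigma> u \<notin> W.span (\<sigma> ` S)" using insert.prems(3) by (simp add: W.independent_insert)
    have Q_eq: "Q' (g u) = Q' (\<sigma> u)" using insert.prems(4) g(1) by (simp add: isometry_def)
    have polar_eq: "polar Q' h (g u) = polar Q' h (\<sigma> u)" if h: "h \<in> \<sigma> ` S" for h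
    proof -
      obtain x where "x \<in> S" "h = \<sigma> x" using h by blast
      then show ?thesis
        using g(2) isometry_polar[OF g(1), of x u] insert.prems(5)[of x u] by simp
    qed
    obtain k where k: "isometry scale' Q' scale' Q' k"
        "\<And>h. h \<in> \<sigma> ` S \<Longrightarrow> k h = h" "k (g u) = \<sigma> u"
      using W.witt_step[OF gu \<sigma>u Q_eq polar_eq] by metis
    have "isometry scale Q scale' Q' (k \<circ> g)"
      using k(1) g(1) unfolding isometry_def by (auto intro: Vector_Spaces.linear_compose)
    moreover have "\<forall>x\<in>insert u S. (k \<circ> g) x = \<sigma> x" using k(2,3) g(2) by auto
    ultimately show ?case by blast
  qed
  then show thesis using that by blast
qed

end

section \<open>Classification by dimension and Arf class\<close>

lemma perfect_field_sqrt:
  fixes a :: "'k::field"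
  assumes "CHAR('k) = 2" "perfect_field TYPE('k)"
  obtains s where "s\<^sup>2 = a"
  using assms unfolding perfect_field_def surj_def by (metis zero_neq_numeral)

context char2_quadratic_space
begin

lemma B_eq_0_on_spans:
  assumes "\<And>x y. x \<in> S \<Longrightarrow> y \<in> T \<Longrightarrow> B x y = 0" "x \<in> span S" "y \<in> span T"
  shows "B x y = 0"
proof (rule B_eq_0_on_span[OF _ assms(2)])
  fix h assume "h \<in> S"
  have "B y h = 0"
    by (rule B_eq_0_on_span[OF _ assms(3)])
      (use assms(1)[OF \<open>h \<in> S\<close>] in \<open>simp add: B_commute[of _ h]\<close>)
  then show "B h y = 0" by (simp add: B_commute[of h])
qed

lemma span_pair: "x \<in> span {y, z} \<longleftrightarrow> (\<exists>a b. x = a *s y + b *s z)"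
proof
  assume "x \<in> span {y, z}"
  then obtain a b where "x - a *s y - b *s z = 0"
    by (auto simp: span_breakdown_eq)
  then show "\<exists>a b. x = a *s y + b *s z"
    by (metis add.commute diff_diff_eq eq_iff_diff_eq_0)
next
  have "a *s y + b *s z \<in> span {y, z}" for a b
    by (intro span_add span_scale span_base) auto
  then show "x \<in> span {y, z}" if "\<exists>a b. x = a *s y + b *s z" using that by blast
qed

lemma symplectic_basis_decomposition:
  assumes "symplectic_basis m e f"
  shows "orthogonal_plane_decomposition scale Q m e f"
proof -
  have fam: "symplectic_family m e f" using assms by (simp add: symplectic_basis_def)
  note D = symplectic_familyD[OF fam]
  have "e i \<noteq> f i \<and> independent {e i, f i}" if "i < m" for i
  proof
    show "e i \<noteq> f i" using D(1,3)[OF that that] by auto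
    show "independent {e i, f i}"
      using symplectic_family_vectors(1)[OF fam] by (rule independent_mono) (use that in auto)
  qed
  moreover have "orth Q x y"
    if "i < m" "j < m" "i \<noteq> j" "x \<in> span {e i, f i}" "y \<in> span {e j, f j}" for i j x y
    unfolding orth_def by (rule B_eq_0_on_spans[OF _ that(4,5)]) (use that(1-3) D in auto)
  moreover have "\<exists>!u. (\<forall>i<m. u i \<in> span {e i, f i}) \<and> (\<forall>i\<ge>m. u i = 0) \<and> v = (\<Sum>i<m. u i)" for v
  proof (rule ex1I)
    let ?u = "\<lambda>i. if i < m then B v (f i) *s e i + B v (e i) *s f i else 0"
    show "(\<forall>i<m. ?u i \<in> span {e i, f i}) \<and> (\<forall>i\<ge>m. ?u i = 0) \<and> v = (\<Sum>i<m. ?u i)"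
      using symplectic_expansion[OF assms, of v] by (auto simp: span_pair combine_def)
    fix u assume u: "(\<forall>i<m. u i \<in> span {e i, f i}) \<and> (\<forall>i\<ge>m. u i = 0) \<and> v = (\<Sum>i<m. u i)"
    then have "\<forall>i. \<exists>a b. i < m \<longrightarrow> u i = a *s e i + b *s f i" by (metis span_pair)
    then obtain a b where ab: "\<And>i. i < m \<Longrightarrow> u i = a i *s e i + b i *s f i" by metis
    then have "v = combine m e f a b" using u by (simp add: combine_def)
    then show "u = ?u" using ab u B_combine[OF fam] by (intro ext) auto
  qed
  ultimately show ?thesis unfolding orthogonal_plane_decomposition_def by blast
qed

text \<open>If \<open>B\<close> vanished on one of the planes, its first vector would be orthogonal to the whole space.\<close>

lemma decomposition_symplectic_basis:
  assumes "orthogonal_plane_decomposition scale Q m e1 e2"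
  shows "symplectic_basis m e1 (\<lambda>i. inverse (B (e1 i) (e2 i)) *s e2 i)"
    and "i < m \<Longrightarrow> the (arf_pair Q (e1 i) (e2 i)) =
      Q (e1 i) * Q (inverse (B (e1 i) (e2 i)) *s e2 i)"
proof -
  note dec = assms[unfolded orthogonal_plane_decomposition_def]
  have total: "x = 0" if x: "\<And>i. i < m \<Longrightarrow> B x (e1 i) = 0 \<and> B x (e2 i) = 0" for x
  proof (rule nondegenerate)
    fix v
    obtain u where u: "\<forall>i<m. u i \<in> span {e1 i, e2 i}" "v = (\<Sum>i<m. u i)" using dec by metis
    have "B x (u i) = 0" if "i < m" for i
      by (rule B_eq_0_on_spans[of "{x}" "{e1 i, e2 i}"])
        (use x[OF that] u(1) that in \<open>auto intro: span_base\<close>)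
    then show "B x v = 0" unfolding u(2) B_sum_right by simp
  qed
  have orthogonal: "B (e1 i) (e1 j) = 0" "B (e1 i) (e2 j) = 0" "B (e2 i) (e2 j) = 0"
    if "i < m" "j < m" "i \<noteq> j" for i j
    using dec that unfolding orth_def by (meson insertCI span_base)+
  have nz: "B (e1 i) (e2 i) \<noteq> 0" if i: "i < m" for i
  proof
    assume "B (e1 i) (e2 i) = 0"
    then have "B (e1 i) (e1 j) = 0 \<and> B (e1 i) (e2 j) = 0" if "j < m" for j
      using orthogonal[OF i that] by (cases "i = j") auto
    then have "e1 i = 0" by (rule total)
    then show False using dec i dependent_zero by (metis insertI1)
  qed
  show "symplectic_basis m e1 (\<lambda>i. inverse (B (e1 i) (e2 i)) *s e2 i)"
    unfolding symplectic_basis_def symplectic_family_def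
    using orthogonal nz total by (auto simp: B_bilinear)
  show "the (arf_pair Q (e1 i) (e2 i)) = Q (e1 i) * Q (inverse (B (e1 i) (e2 i)) *s e2 i)"
    if "i < m"
    using nz[OF that] by (simp add: arf_pair_def Q_scale field_simps)
qed

text \<open>The class is a choice among the values at all decompositions. As there is a decomposition
at all, the chosen value is attained at one of them, and this one is turned into a symplectic basis.\<close>

lemma arf_class_symplectic_basis:
  obtains m e f where "symplectic_basis m e f"
    "arf_class scale Q = frakH_class (\<Sum>i<m. Q (e i) * Q (f i))"
proof -
  let ?is_arf = "\<lambda>C. \<exists>m e1 e2. orthogonal_plane_decomposition scale Q m e1 e2 \<and>
    C = frakH_class (\<Sum>i<m. the (arf_pair Q (e1 i) (e2 i)))"
  have "\<exists>C. ?is_arf C"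
    using symplectic_basis_exists symplectic_basis_decomposition by metis
  then have "?is_arf (arf_class scale Q)" unfolding arf_class_def by (rule someI_ex)
  then obtain m e1 e2 where dec: "orthogonal_plane_decomposition scale Q m e1 e2"
      "arf_class scale Q = frakH_class (\<Sum>i<m. the (arf_pair Q (e1 i) (e2 i)))" by blast
  show thesis
    by (rule that[OF decomposition_symplectic_basis(1)[OF dec(1)]])
      (use dec decomposition_symplectic_basis(2)[OF dec(1)] in simp)
qed

text \<open>If \<open>Q\<close> does not vanish on both vectors, put one with a nonzero value first and rescale by a
square root of this value and its inverse, which leaves \<open>Q(x) Q(y)\<close> unchanged. If both vectors are
singular, \<open>x + y\<close> has the value 1.\<close>

lemma unit_plane_basis:
  assumes "perfect_field TYPE('k)" "B x y = 1"
  obtains p q where "p \<in> span {x, y}" "q \<in> span {x, y}" "x \<in> span {p, q}" "y \<in> span {p, q}"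
    "B p q = 1" "Q p = 1" "Q q = Q x * Q y"
proof -
  note result = that
  have scaled: thesis if xy: "{u, v} = {x, y}" "B u v = 1" "Q u \<noteq> 0" for u v
  proof -
    obtain s where s: "s\<^sup>2 = Q u" using perfect_field_sqrt[OF CHAR_2 assms(1)] .
    then have "s \<noteq> 0" using xy(3) by auto
    have uv: "u = s *s (inverse s *s u) + 0 *s (s *s v)"
      "v = 0 *s (inverse s *s u) + inverse s *s (s *s v)"
      using \<open>s \<noteq> 0\<close> by simp_all
    have span: "u \<in> span {inverse s *s u, s *s v}" "v \<in> span {inverse s *s u, s *s v}"
      using uv unfolding span_pair by blast+
    have "Q u * Q v = Q x * Q y" using xy(1) by (auto simp: doubleton_eq_iff)
    then show thesis
      using \<open>s \<noteq> 0\<close> s xy span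
      by (intro result[of "inverse s *s u" "s *s v"])
        (auto simp: B_bilinear Q_scale power_inverse doubleton_eq_iff intro: span_scale span_base)
  qed
  consider "Q x \<noteq> 0" | "Q y \<noteq> 0" | "Q x = 0" "Q y = 0" by blast
  then show thesis
  proof cases
    case 1
    then show thesis using scaled[of x y] assms(2) by simp
  next
    case 2
    then show thesis using scaled[of y x] assms(2) by (simp add: B_commute insert_commute)
  next
    case 3
    have "x = 1 *s (x + y) + 1 *s y" by (simp add: add.assoc)
    then have "x \<in> span {x + y, y}" unfolding span_pair by blast
    then show thesis
      using 3 assms(2)
      by (intro result[of "x + y" y]) (auto simp: Q_add B_bilinear intro: span_add span_base)
  qed
qed

lemma unit_symplectic_basis:
  assumes "perfect_field TYPE('k)" "symplectic_basis m e f"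
  obtains e' f' where "symplectic_basis m e' f'"
    "\<And>i. i < m \<Longrightarrow> Q (e' i) = 1" "\<And>i. i < m \<Longrightarrow> Q (f' i) = Q (e i) * Q (f i)"
proof -
  have fam: "symplectic_family m e f" using assms(2) by (simp add: symplectic_basis_def)
  note D = symplectic_familyD[OF fam]
  have "\<forall>i. \<exists>p q. i < m \<longrightarrow> p \<in> span {e i, f i} \<and> q \<in> span {e i, f i} \<and>
      e i \<in> span {p, q} \<and> f i \<in> span {p, q} \<and> B p q = 1 \<and> Q p = 1 \<and> Q q = Q (e i) * Q (f i)"
    using unit_plane_basis[OF assms(1)] D(1) by metis
  then obtain e' f' where new: "\<And>i. i < m \<Longrightarrow> e' i \<in> span {e i, f i} \<and> f' i \<in> span {e i, f i} \<and>
      e i \<in> span {e' i, f' i} \<and> f i \<in> span {e' i, f' i} \<and>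
      B (e' i) (f' i) = 1 \<and> Q (e' i) = 1 \<and> Q (f' i) = Q (e i) * Q (f i)"
    by metis
  have orthogonal: "B x y = 0"
    if "i < m" "j < m" "i \<noteq> j" "x \<in> span {e i, f i}" "y \<in> span {e j, f j}" for i j x y
    by (rule B_eq_0_on_spans[OF _ that(4,5)]) (use that(1-3) D in auto)
  have "symplectic_family m e' f'"
    unfolding symplectic_family_def
  proof (intro allI impI)
    fix i j assume "i < m" "j < m"
    then show "B (e' i) (f' j) = (if i = j then 1 else 0) \<and> B (e' i) (e' j) = 0 \<and> B (f' i) (f' j) = 0"
      using new[of i] new[of j] orthogonal[of i j] by (cases "i = j") auto
  qed
  moreover have "x = 0" if x: "\<forall>i<m. B x (e' i) = 0 \<and> B x (f' i) = 0" for x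
  proof -
    have "B x y = 0" if "i < m" "y \<in> span {e' i, f' i}" for i y
      by (rule B_eq_0_on_spans[of "{x}", OF _ _ that(2)]) (use x that(1) in \<open>auto intro: span_base\<close>)
    then show ?thesis using new assms(2) unfolding symplectic_basis_def by blast
  qed
  ultimately have "symplectic_basis m e' f'" unfolding symplectic_basis_def by blast
  then show thesis by (rule that) (use new in auto)
qed

text \<open>Write \<open>[a, b]\<close> for a plane with a basis \<open>e, f\<close> such that \<open>Q(e) = a\<close>, \<open>Q(f) = b\<close> and
\<open>B(e, f) = 1\<close>. In characteristic 2, \<open>[1, \<alpha>] + [1, \<beta>] \<cong> [1, \<alpha> + \<beta>] + [0, 0]\<close> via the pairs
\<open>(e\<^sub>0, f\<^sub>0 + f\<^sub>1)\<close> and \<open>(e\<^sub>0 + e\<^sub>1, f\<^sub>1 + \<beta> (e\<^sub>0 + e\<^sub>1))\<close>. The new basis does this for all planes at once, so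
that only the plane of index 0 is not hyperbolic and carries the sum of the Arf invariants. Adding
\<open>c e\<^sub>0\<close> to its second vector changes that sum by \<open>c + c\<^sup>2\<close>.\<close>

lemma normal_symplectic_basis:
  assumes "symplectic_basis m e f" "\<And>i. i < m \<Longrightarrow> Q (e i) = 1"
  obtains e' f' where "symplectic_basis m e' f'"
    "\<And>i. i < m \<Longrightarrow> Q (e' i) = (if i = 0 then 1 else 0)"
    "\<And>i. i < m \<Longrightarrow> Q (f' i) = (if i = 0 then (\<Sum>j<m. Q (f j)) + frakH c else 0)"
proof -
  have fam: "symplectic_family m e f" using assms(1) by (simp add: symplectic_basis_def)
  note D = symplectic_familyD[OF fam]
  define F where "F = (\<Sum>j<m. f j)"
  define e' where "e' = (\<lambda>i. if i = 0 then e 0 else e 0 + e i)"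
  define f' where "f' = (\<lambda>i. if i = 0 then F + c *s e 0 else f i + Q (f i) *s (e 0 + e i))"
  have F: "B (e i) F = 1" "B F (e i) = 1" "B (f i) F = 0" "B F (f i) = 0" if "i < m" for i
    using that D by (simp_all add: F_def B_sum_left B_sum_right)
  have QF: "Q F = (\<Sum>j<m. Q (f j))"
    unfolding F_def using D by (intro Q_sum_orthogonal) auto
  have "symplectic_family m e' f'"
    unfolding symplectic_family_def e'_def f'_def
    using D F by (auto simp: B_bilinear)
  moreover have "x = 0" if x: "\<forall>i<m. B x (e' i) = 0 \<and> B x (f' i) = 0" for x
  proof -
    have e0: "B x (e 0) = 0" if "0 < m" using x that by (force simp: e'_def)
    have e: "B x (e i) = 0" if "i < m" for i
      using x that e0 by (cases "i = 0") (force simp: e'_def B_bilinear)+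
    have f: "B x (f i) = 0" if "i < m" "i \<noteq> 0" for i
    proof -
      have "B x (f' i) = 0" using x that by blast
      then show ?thesis using e[of i] e[of 0] that by (simp add: f'_def B_bilinear)
    qed
    have "B x (f 0) = 0" if "0 < m"
    proof -
      have "B x (f' 0) = 0" using x that by blast
      then have "(\<Sum>j<m. B x (f j)) = 0"
        using e[OF that] by (simp add: f'_def F_def B_bilinear B_sum_right)
      moreover have "(\<Sum>j<m. B x (f j)) = B x (f 0)"
        using that f by (subst sum.remove[of _ 0]) auto
      ultimately show ?thesis by simp
    qed
    then have "B x (f i) = 0" if "i < m" for i using f that by (cases "i = 0") auto
    then show ?thesis using e assms(1) unfolding symplectic_basis_def by blast
  qed
  ultimately have "symplectic_basis m e' f'" unfolding symplectic_basis_def by blast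
  then show thesis
    by (rule that) (use assms(2) D F QF in
      \<open>auto simp: e'_def f'_def Q_add Q_scale B_bilinear frakH_def add_ac\<close>)
qed

end

context char2_quadratic_space_pair
begin

lemma isometry_of_symplectic_bases:
  assumes "V.symplectic_basis m e f" "W.symplectic_basis m e' f'"
    and "\<And>i. i < m \<Longrightarrow> Q' (e' i) = Q (e i)" "\<And>i. i < m \<Longrightarrow> Q' (f' i) = Q (f i)"
  obtains g where "isometry scale Q scale' Q' g"
proof -
  let ?g = "\<lambda>x. W.combine m e' f' (\<lambda>i. polar Q x (f i)) (\<lambda>i. polar Q x (e i))"
  have "Vector_Spaces.linear scale scale' ?g"
    unfolding Vector_Spaces.linear_iff using V.vector_space_axioms W.vector_space_axioms
    by (simp add: W.combine_def V.B_bilinear W.scale_left_distrib W.scale_right_distrib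
        W.scale_sum_right sum.distrib add_ac)
  moreover have "Q' (?g x) = Q x" for x
  proof -
    have "Q' (?g x) = Q (V.combine m e f (\<lambda>i. polar Q x (f i)) (\<lambda>i. polar Q x (e i)))"
      using assms(1,2) unfolding V.symplectic_basis_def W.symplectic_basis_def
      by (simp add: V.Q_combine W.Q_combine assms(3,4))
    then show ?thesis by (simp add: V.symplectic_expansion[OF assms(1)])
  qed
  ultimately show thesis by (intro that[of ?g]) (simp add: isometry_def)
qed

text \<open>Both spaces have normal symplectic bases, with values \<open>\<alpha>\<close> and \<open>\<alpha>'\<close> in the distinguished
plane. Equality of the classes says \<open>\<alpha>' = \<alpha> + c + c\<^sup>2\<close>, and this difference is absorbed in the choice of
the basis of the first space.\<close>

theorem isometric_if_arf_class_eq: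
  assumes "perfect_field TYPE('k)" "V.dim UNIV = W.dim UNIV"
    and "arf_class scale Q = arf_class scale' Q'"
  obtains g where "isometry scale Q scale' Q' g"
proof -
  obtain m e f where basis: "V.symplectic_basis m e f"
    and arf: "arf_class scale Q = frakH_class (\<Sum>i<m. Q (e i) * Q (f i))"
    by (rule V.arf_class_symplectic_basis)
  obtain m' e' f' where basis': "W.symplectic_basis m' e' f'"
    and arf': "arf_class scale' Q' = frakH_class (\<Sum>i<m'. Q' (e' i) * Q' (f' i))"
    by (rule W.arf_class_symplectic_basis)
  have m': "m' = m"
    using V.symplectic_basis_dim[OF basis] W.symplectic_basis_dim[OF basis'] assms(2) by simp
  have "frakH (0::'k) = 0" by (simp add: frakH_def)
  then have "(\<Sum>i<m'. Q' (e' i) * Q' (f' i)) \<in> frakH_class (\<Sum>i<m'. Q' (e' i) * Q' (f' i))"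
    unfolding frakH_class_def by (metis add.right_neutral imageI rangeI)
  then obtain c where c: "(\<Sum>i<m. Q' (e' i) * Q' (f' i)) = (\<Sum>i<m. Q (e i) * Q (f i)) + frakH c"
    using arf arf' assms(3) unfolding frakH_class_def m' by auto
  obtain e1 f1 where unit: "V.symplectic_basis m e1 f1" "\<And>i. i < m \<Longrightarrow> Q (e1 i) = 1"
      "\<And>i. i < m \<Longrightarrow> Q (f1 i) = Q (e i) * Q (f i)"
    using V.unit_symplectic_basis[OF assms(1) basis] by blast
  obtain e2 f2 where normal: "V.symplectic_basis m e2 f2"
      "\<And>i. i < m \<Longrightarrow> Q (e2 i) = (if i = 0 then 1 else 0)"
      "\<And>i. i < m \<Longrightarrow> Q (f2 i) = (if i = 0 then (\<Sum>j<m. Q (f1 j)) + frakH c else 0)"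
    using V.normal_symplectic_basis[OF unit(1,2), of c] by blast
  obtain e1' f1' where unit': "W.symplectic_basis m e1' f1'" "\<And>i. i < m \<Longrightarrow> Q' (e1' i) = 1"
      "\<And>i. i < m \<Longrightarrow> Q' (f1' i) = Q' (e' i) * Q' (f' i)"
    using W.unit_symplectic_basis[OF assms(1) basis'[unfolded m']] by blast
  obtain e2' f2' where normal': "W.symplectic_basis m e2' f2'"
      "\<And>i. i < m \<Longrightarrow> Q' (e2' i) = (if i = 0 then 1 else 0)"
      "\<And>i. i < m \<Longrightarrow> Q' (f2' i) = (if i = 0 then (\<Sum>j<m. Q' (f1' j)) + frakH 0 else 0)"
    using W.normal_symplectic_basis[OF unit'(1,2), of 0] by blast
  show thesis
  proof (rule isometry_of_symplectic_bases[OF normal(1) normal'(1)])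
    fix i assume "i < m"
    then show "Q' (e2' i) = Q (e2 i)" "Q' (f2' i) = Q (f2 i)"
      using normal(2,3) normal'(2,3) unit(3) unit'(3) c \<open>frakH (0::'k) = 0\<close> by auto
  qed (rule that)
qed

end

section \<open>Universal conformal geometries\<close>

lemma (in vector_space) independent_insert_scale:
  assumes "a \<notin> S" "independent (insert a S)" "c \<noteq> 0"
  shows "scale c a \<notin> S" "independent (insert (scale c a) S)"
proof -
  have "scale (inverse c) (scale c a) = a" using assms(3) by simp
  moreover have "a \<notin> span S" using assms(1,2) by (simp add: independent_insert)
  ultimately have "scale c a \<notin> span S" using span_scale by metis
  then show "scale c a \<notin> S" "independent (insert (scale c a) S)"
    using assms(1,2) span_base by (auto simp: independent_insert)
qed

lemma (in vector_space) independent_scale_triple: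
  assumes "distinct [x, y, z]" "independent {x, y, z}" "a \<noteq> 0" "b \<noteq> 0" "c \<noteq> 0"
  shows "distinct [scale a x, scale b y, scale c z]"
    "independent {scale a x, scale b y, scale c z}"
proof -
  let ?x = "scale a x" and ?y = "scale b y" and ?z = "scale c z"
  have 1: "?x \<notin> {y, z}" "independent {y, z, ?x}"
    using independent_insert_scale[of x "{y, z}" a] assms by (auto simp: insert_commute)
  have 2: "?y \<notin> {z, ?x}" "independent {z, ?x, ?y}"
    using independent_insert_scale[of y "{z, ?x}" b] 1 assms by (auto simp: insert_commute)
  have 3: "?z \<notin> {?x, ?y}" "independent {?z, ?x, ?y}"
    using independent_insert_scale[of z "{?x, ?y}" c] 1 2 assms by (auto simp: insert_commute)
  show "distinct [?x, ?y, ?z]" using 2 3 by auto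
  show "independent {?x, ?y, ?z}" using 3(2) by (simp add: insert_commute)
qed

lemma universal_conformal_geometry_char2:
  assumes "universal_conformal_geometry scale Q \<Omega> P L" "CHAR('k::field) = 2"
  shows "char2_quadratic_space (scale :: 'k \<Rightarrow> 'v::ab_group_add \<Rightarrow> 'v) Q"
  using assms unfolding universal_conformal_geometry_def
  by (intro char2_quadratic_space.intro char2_quadratic_space_axioms.intro) auto

text \<open>If \<open>Q(\<Omega>) = 0\<close>, then \<open>\<Omega> \<in> \<Omega>\<^sup>\<bottom>\<close> would itself be in the radical.\<close>

lemma Q_Omega_nonzero:
  assumes "universal_conformal_geometry scale Q \<Omega> P L" "CHAR('k::field) = 2"
  shows "(Q :: 'v::ab_group_add \<Rightarrow> 'k) \<Omega> \<noteq> 0"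
proof
  interpret universal_conformal_geometry scale Q \<Omega> P L by fact
  interpret char2_quadratic_space scale Q
    by (rule universal_conformal_geometry_char2) fact+
  assume "Q \<Omega> = 0"
  then have "\<Omega> \<in> radical_on Q (orth_compl Q \<Omega>)"
    by (auto simp: radical_on_def orth_compl_def orth_def Q_add)
  then have "\<Omega> = 0" using radical_trivial by blast
  then show False using independent_points dependent_zero by blast
qed

context char2_quadratic_space
begin

lemma arf_pair_scale:
  assumes "a \<noteq> 0" "b \<noteq> 0"
  shows "arf_pair Q (a *s x) (b *s y) = arf_pair Q x y"
  using assms by (simp add: arf_pair_def B_bilinear Q_scale power_mult_distrib)

end

context char2_quadratic_space_pair
begin

text \<open>The Arf invariant of a pair, together with the value of \<open>Q\<close> at its first vector, determines the
second vector up to scaling as far as \<open>Q\<close> and \<open>B\<close> are concerned. If \<open>B(v, x) \<noteq> 0\<close>, the factor is forced by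
\<open>B\<close>. If \<open>B(v, x) = 0\<close>, the invariant is infinite and carries no information, but then \<open>Q(x) \<noteq> 0 \<noteq> Q'(y)\<close>
and a square root makes the values of \<open>Q\<close> agree.\<close>

lemma matching_multiple:
  assumes "perfect_field TYPE('k)" "Q' w = Q v" "Q v \<noteq> 0"
    and arf: "arf_pair Q v x = arf_pair Q' w y"
    and "Q x \<noteq> 0 \<or> arf_pair Q v x \<noteq> None" "Q' y \<noteq> 0 \<or> arf_pair Q' w y \<noteq> None"
  obtains b where "b \<noteq> 0" "Q' (scale' b y) = Q x" "polar Q' w (scale' b y) = polar Q v x"
proof (cases "polar Q v x = 0")
  case True
  then have None: "arf_pair Q v x = None" "arf_pair Q' w y = None" using arf by (auto simp: arf_pair_def)
  then have nz: "Q x \<noteq> 0" "Q' y \<noteq> 0" using assms(5,6) by auto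
  obtain b where b: "b\<^sup>2 = Q x / Q' y" using perfect_field_sqrt[OF V.CHAR_2 assms(1)] .
  have "polar Q' w y = 0" using None(2) by (simp add: arf_pair_def split: if_splits)
  moreover have "b \<noteq> 0" using b nz by auto
  ultimately show thesis
    using True b nz by (intro that[of b]) (simp_all add: W.Q_scale W.B_bilinear)
next
  case False
  then have nz: "polar Q' w y \<noteq> 0" using arf by (auto simp: arf_pair_def split: if_splits)
  then have eq: "Q v * Q x / (polar Q v x)\<^sup>2 = Q v * Q' y / (polar Q' w y)\<^sup>2"
    using arf False by (simp add: arf_pair_def assms(2))
  define b where "b = polar Q v x / polar Q' w y"
  have "Q x / (polar Q v x)\<^sup>2 = Q' y / (polar Q' w y)\<^sup>2"
    using eq assms(3) by (simp flip: times_divide_eq_right)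
  then have "b\<^sup>2 * Q' y = Q x"
    using False nz by (simp add: b_def power_divide field_simps)
  then show thesis
    using False nz by (intro that[of b]) (simp_all add: b_def W.Q_scale W.B_bilinear)
qed

end

text \<open>After rescaling, \<open>\<Omega>', P', L'\<close> have the same Gram data as \<open>\<Omega>, P, L\<close>: the values and pairings
involving \<open>\<Omega>\<close> agree by the choice of the factors, and \<open>P \<bottom> L\<close> on both sides. So Witt's theorem
applies to the correspondence of the two triples.\<close>

theorem isometric_geometries_if_invariants_eq:
  fixes scale :: "'k::field \<Rightarrow> 'v::ab_group_add \<Rightarrow> 'v"
    and scale' :: "'k \<Rightarrow> 'w::ab_group_add \<Rightarrow> 'w"
  assumes char: "CHAR('k) = 2" and perfect: "perfect_field TYPE('k)"
    and geometry: "universal_conformal_geometry scale Q \<Omega> P L"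
      "universal_conformal_geometry scale' Q' \<Omega>' P' L'"
    and dim: "vector_space.dim scale UNIV = vector_space.dim scale' UNIV"
    and arf: "arf_class scale Q = arf_class scale' Q'"
      "arf_pair Q \<Omega> P = arf_pair Q' \<Omega>' P'" "arf_pair Q \<Omega> L = arf_pair Q' \<Omega>' L'"
  shows "isometric_geometries scale Q \<Omega> P L scale' Q' \<Omega>' P' L'"
proof -
  interpret V: universal_conformal_geometry scale Q \<Omega> P L by fact
  interpret W: universal_conformal_geometry scale' Q' \<Omega>' P' L' by fact
  interpret char2_quadratic_space_pair scale Q scale' Q'
    using universal_conformal_geometry_char2[OF geometry(1) char]
      universal_conformal_geometry_char2[OF geometry(2) char]
    by (rule char2_quadratic_space_pair.intro)
  have nz: "Q \<Omega> \<noteq> 0" "Q' \<Omega>' \<noteq> 0" using Q_Omega_nonzero geometry char by blast+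
  obtain a where a: "a\<^sup>2 = Q \<Omega> / Q' \<Omega>'" using perfect_field_sqrt[OF char perfect] .
  then have "a \<noteq> 0" using nz by auto
  have Q\<Omega>: "Q' (scale' a \<Omega>') = Q \<Omega>" using a nz by (simp add: W.Q_scale)
  have arf_a: "arf_pair Q' (scale' a \<Omega>') y = arf_pair Q' \<Omega>' y" for y
    using W.arf_pair_scale[OF \<open>a \<noteq> 0\<close>, of 1] by simp
  obtain b where b: "b \<noteq> 0" "Q' (scale' b P') = Q P"
      "polar Q' (scale' a \<Omega>') (scale' b P') = polar Q \<Omega> P"
    using matching_multiple[OF perfect Q\<Omega> nz(1), of P P'] arf(2) V.P_condition W.P_condition
    unfolding arf_a by blast
  obtain c where c: "c \<noteq> 0" "Q' (scale' c L') = Q L"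
      "polar Q' (scale' a \<Omega>') (scale' c L') = polar Q \<Omega> L"
    using matching_multiple[OF perfect Q\<Omega> nz(1), of L L'] arf(3) V.L_condition W.L_condition
    unfolding arf_a by blast
  have PL: "polar Q' (scale' b P') (scale' c L') = polar Q P L"
    using V.P_orth_L W.P_orth_L by (simp add: orth_def W.B_bilinear)
  define \<sigma> where "\<sigma> x = (if x = \<Omega> then scale' a \<Omega>' else if x = P then scale' b P' else scale' c L')" for x
  have \<sigma>: "\<sigma> \<Omega> = scale' a \<Omega>'" "\<sigma> P = scale' b P'" "\<sigma> L = scale' c L'"
    using V.distinct_points by (auto simp: \<sigma>_def)
  note triple = W.independent_scale_triple[OF W.distinct_points W.independent_points \<open>a \<noteq> 0\<close> b(1) c(1)]
  obtain g0 where "isometry scale Q scale' Q' g0"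
    using isometric_if_arf_class_eq[OF perfect dim arf(1)] .
  moreover have "inj_on \<sigma> {\<Omega>, P, L}" using triple(1) by (auto simp: inj_on_def \<sigma>)
  moreover have "W.independent (\<sigma> ` {\<Omega>, P, L})" using triple(2) by (simp add: \<sigma>)
  moreover have "Q' (\<sigma> x) = Q x" if "x \<in> {\<Omega>, P, L}" for x
    using that Q\<Omega> b(2) c(2) by (auto simp: \<sigma>)
  moreover have "polar Q' (\<sigma> x) (\<sigma> y) = polar Q x y" if "x \<in> {\<Omega>, P, L}" "y \<in> {\<Omega>, P, L}" for x y
    using that b(3) c(3) PL V.B_commute W.B_commute by (auto simp: \<sigma>)
  ultimately obtain g where g: "isometry scale Q scale' Q' g" "\<And>x. x \<in> {\<Omega>, P, L} \<Longrightarrow> g x = \<sigma> x"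
    using witt_extension[of g0 "{\<Omega>, P, L}" \<sigma>] V.independent_points by blast
  have "g \<Omega> = scale' a \<Omega>'" "g P = scale' b P'" "g L = scale' c L'" using g(2) \<sigma> by auto
  then show ?thesis
    unfolding isometric_geometries_def
    using g(1) isometry_bij[OF g(1) dim] \<open>a \<noteq> 0\<close> b(1) c(1) unfolding isometry_def by blast
qed

theorem normalised_representative:
  assumes char: "CHAR('k::field) = 2" and perfect: "perfect_field TYPE('k)"
    and geometry: "universal_conformal_geometry (scale :: 'k \<Rightarrow> 'v::ab_group_add \<Rightarrow> 'v) Q \<Omega> P L"
  shows "\<exists>c. c \<noteq> 0 \<and> Q (scale c \<Omega>) = 1 \<and>
    universal_conformal_geometry scale Q (scale c \<Omega>) P L \<and>
    arf_pair Q (scale c \<Omega>) P = arf_pair Q \<Omega> P \<and>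
    arf_pair Q (scale c \<Omega>) L = arf_pair Q \<Omega> L"
proof -
  interpret universal_conformal_geometry scale Q \<Omega> P L by fact
  interpret char2_quadratic_space scale Q
    by (rule universal_conformal_geometry_char2) fact+
  obtain c where c: "c\<^sup>2 = inverse (Q \<Omega>)" using perfect_field_sqrt[OF char perfect] .
  have nz: "Q \<Omega> \<noteq> 0" using Q_Omega_nonzero[OF geometry char] .
  then have "c \<noteq> 0" using c by auto
  have arf: "arf_pair Q (scale c \<Omega>) y = arf_pair Q \<Omega> y" for y
    using arf_pair_scale[OF \<open>c \<noteq> 0\<close>, of 1] by simp
  have compl: "orth_compl Q (scale c \<Omega>) = orth_compl Q \<Omega>"
    using \<open>c \<noteq> 0\<close> by (simp add: orth_compl_def orth_def B_bilinear)
  have "distinct [scale c \<Omega>, P, L]" "independent {scale c \<Omega>, P, L}"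
    using independent_scale_triple[OF distinct_points independent_points \<open>c \<noteq> 0\<close>, of 1 1] by simp_all
  then have "universal_conformal_geometry scale Q (scale c \<Omega>) P L"
    using dim_even radical_trivial P_orth_L P_condition L_condition
    by unfold_locales (simp_all add: arf compl)
  moreover have "Q (scale c \<Omega>) = 1" using c nz by (simp add: Q_scale)
  ultimately show ?thesis using \<open>c \<noteq> 0\<close> arf by blast
qed

theorem theorem4p2:
  fixes d :: nat
    and scale :: "'k::field \<Rightarrow> 'v::ab_group_add \<Rightarrow> 'v"
    and Q :: "'v \<Rightarrow> 'k" and \<Omega> P L :: 'v
    and scale' :: "'k \<Rightarrow> 'w::ab_group_add \<Rightarrow> 'w"
    and Q' :: "'w \<Rightarrow> 'k" and \<Omega>' P' L' :: 'w
  assumes "CHAR('k) = 2" and "perfect_field TYPE('k)"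
  shows
    "(universal_conformal_geometry scale Q \<Omega> P L \<and>
      universal_conformal_geometry scale' Q' \<Omega>' P' L' \<and>
      vector_space.dim scale UNIV = d \<and> vector_space.dim scale' UNIV = d \<and>
      (d \<ge> 6 \<or> d = 4 \<and> \<not> (arf_pair Q \<Omega> P = Some 0 \<and> arf_pair Q \<Omega> L = Some 0)) \<and>
      arf_class scale Q = arf_class scale' Q' \<and>
      arf_pair Q \<Omega> P = arf_pair Q' \<Omega>' P' \<and>
      arf_pair Q \<Omega> L = arf_pair Q' \<Omega>' L'
      \<longrightarrow> isometric_geometries scale Q \<Omega> P L scale' Q' \<Omega>' P' L') \<and>
     (universal_conformal_geometry scale Q \<Omega> P L
      \<longrightarrow> (\<exists>c. c \<noteq> 0 \<and> Q (scale c \<Omega>) = 1 \<and>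
             universal_conformal_geometry scale Q (scale c \<Omega>) P L \<and>
             arf_pair Q (scale c \<Omega>) P = arf_pair Q \<Omega> P \<and>
             arf_pair Q (scale c \<Omega>) L = arf_pair Q \<Omega> L))"
  using isometric_geometries_if_invariants_eq[of scale Q \<Omega> P L scale' Q' \<Omega>' P' L']
    normalised_representative[of scale Q \<Omega> P L] assms
  by simp

end
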